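(* Let $f: [0,1] \to \mathbb{R}$ be a real-valued differentiable function such that $f(0) = 0$ and such that for every integer $n > 1$ there exists $\delta_n \in (0,1]$ with $$|f(x)| < x^n \qquad \text{for all } x \in (0, \delta_n).$$ Assume moreover that there exists $C > 0$ such that $$|x f'(x)| \le C\, |f(x)| \qquad \text{for all } x \in [0,1].$$ Then $f(x) = 0$ for every $x \in [0,1]$.
   Context: Differentiability on $[0,1]$ means differentiability at every point of $[0,1]$, with one-sided derivatives at the endpoints $0$ and $1$. No continuity or Riemann integrability of $f'$ is assumed. *)

theory Defs
  imports "HOL-Analysis.Analysis"
begin

end

theory Submission
  imports Defs
begin

text \<open>
  The bound says that the logarithmic derivative of \<open>f\<close> is at most \<open>C / x\<close> in absolute value, so
  \<open>f\<close> can change by at most the factor \<open>(y / x) ^ n\<close> between \<open>x\<close> and \<open>y\<close> once \<open>n \<ge> C\<close>: it cannot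
  grow faster than a power. Flatness at \<open>0\<close> lets \<open>f\<close> start below every power, and a function that
  starts at nothing and grows by a bounded factor stays at nothing.

  Dividing by \<open>f\<close> would require \<open>f \<noteq> 0\<close>, and integrating \<open>f'\<close> would require integrability. Both
  are avoided by working with the square of \<open>f x / x ^ n\<close>: its derivative is
  \<open>2 * (x * f x * f' x - n * (f x)\<^sup>2) / x ^ (2 * n + 1) \<le> 0\<close>, so by the mean value theorem it is
  nonincreasing (lemma \<open>square_quotient_power_antimono\<close>), while flatness of order \<open>n + 1\<close> makes it
  tend to \<open>0\<close> at \<open>0\<close>. Being nonnegative, it vanishes.
\<close>

text \<open>
  This is the differential form of Gronwall's inequality for the equation \<open>x * f' x = n * f x\<close>,
  whose solutions are the multiples of \<open>x ^ n\<close>. Squaring makes the one hypothesis cover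
  both signs of \<open>f\<close>.
\<close>

lemma square_quotient_power_antimono:
  fixes f f' :: "real \<Rightarrow> real"
  assumes "0 < x" "x \<le> y"
    and cont: "continuous_on {x..y} f"
    and deriv: "\<And>t. x < t \<Longrightarrow> t < y \<Longrightarrow> (f has_real_derivative f' t) (at t)"
    and growth: "\<And>t. x < t \<Longrightarrow> t < y \<Longrightarrow> f t * (t * f' t) \<le> real n * (f t)\<^sup>2"
  shows "(f y / y ^ n)\<^sup>2 \<le> (f x / x ^ n)\<^sup>2"
proof (cases "x = y")
  case False
  let ?h = "\<lambda>t. (f t / t ^ n)\<^sup>2"
  show ?thesis
  proof (rule DERIV_nonpos_imp_decreasing_open[where f = ?h])
    show "x \<le> y"
      by fact
    show "continuous_on {x..y} ?h"
      using \<open>0 < x\<close> by (intro continuous_intros cont) auto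
  next
    fix t assume t: "x < t" "t < y"
    then have "t > 0"
      using \<open>0 < x\<close> by simp
    let ?D = "2 * (f t * (t * f' t) - real n * (f t)\<^sup>2) / (t * (t ^ n)\<^sup>2)"
    have power_pred: "real n * t ^ (n - 1) = real n * t ^ n / t"
      using \<open>t > 0\<close> by (cases n) auto
    have "(?h has_real_derivative
        2 * (f t / t ^ n) * ((f' t * t ^ n - f t * (real n * t ^ (n - 1))) / (t ^ n * t ^ n))) (at t)"
      using \<open>t > 0\<close> by (auto intro!: derivative_eq_intros deriv t simp: mult_ac)
    moreover have "2 * (f t / t ^ n) *
        ((f' t * t ^ n - f t * (real n * t ^ (n - 1))) / (t ^ n * t ^ n)) = ?D"
      unfolding power_pred using \<open>t > 0\<close> by (simp add: field_simps power2_eq_square)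
    ultimately have "(?h has_real_derivative ?D) (at t)"
      by simp
    moreover have "?D \<le> 0"
      using growth[OF t] \<open>t > 0\<close> by (intro divide_nonpos_pos) auto
    ultimately show "\<exists>D. (?h has_real_derivative D) (at t) \<and> D \<le> 0"
      by blast
  qed
qed simp

theorem theorem3:
  fixes f f' :: "real \<Rightarrow> real"
  assumes deriv: "\<And>x. x \<in> {0..1} \<Longrightarrow> (f has_real_derivative f' x) (at x within {0..1})"
    and zero: "f 0 = 0"
    and flat: "\<And>n::nat. n > 1 \<Longrightarrow> \<exists>\<delta>\<in>{0<..1}. \<forall>x\<in>{0<..<\<delta>}. \<bar>f x\<bar> < x ^ n"
    and bound: "\<exists>C>0. \<forall>x\<in>{0..1}. \<bar>x * f' x\<bar> \<le> C * \<bar>f x\<bar>"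
  shows "\<forall>x\<in>{0..1}. f x = 0"
proof
  fix y :: real assume y: "y \<in> {0..1}"
  obtain C where "C > 0" and C: "\<And>x. x \<in> {0..1} \<Longrightarrow> \<bar>x * f' x\<bar> \<le> C * \<bar>f x\<bar>"
    using bound by blast
  obtain n :: nat where n: "C < real n"
    using reals_Archimedean2 by blast
  have "n > 0"
    using n \<open>C > 0\<close> by (cases n) auto
  have cont: "continuous_on {0..1} f"
    using deriv by (rule DERIV_continuous_on)
  have deriv_at: "(f has_real_derivative f' t) (at t)" if "0 < t" "t < 1" for t
    using deriv[of t] that at_within_Icc_at[of 0 t 1] by simp
  have growth: "f t * (t * f' t) \<le> real n * (f t)\<^sup>2" if "0 < t" "t < 1" for t
  proof -
    have "f t * (t * f' t) \<le> \<bar>f t\<bar> * \<bar>t * f' t\<bar>"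
      by (metis abs_ge_self abs_mult)
    also have "\<dots> \<le> \<bar>f t\<bar> * (real n * \<bar>f t\<bar>)"
    proof (rule mult_left_mono)
      have "\<bar>t * f' t\<bar> \<le> C * \<bar>f t\<bar>"
        using C[of t] that by simp
      also have "\<dots> \<le> real n * \<bar>f t\<bar>"
        using n by (intro mult_right_mono) auto
      finally show "\<bar>t * f' t\<bar> \<le> real n * \<bar>f t\<bar>" .
    qed simp
    finally show ?thesis
      by (simp add: power2_eq_square algebra_simps)
  qed
  show "f y = 0"
  proof (cases "y = 0")
    case False
    with y have "0 < y" "y \<le> 1"
      by auto
    \<comment> \<open>One order of flatness beyond \<open>n\<close> leaves the factor \<open>x\<close> that makes the quotient small.\<close>
    obtain \<delta> where "0 < \<delta>" and \<delta>: "\<And>x. 0 < x \<Longrightarrow> x < \<delta> \<Longrightarrow> \<bar>f x\<bar> < x ^ Suc n"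
      using flat[of "Suc n"] \<open>n > 0\<close> by auto
    have small: "\<bar>f y / y ^ n\<bar> \<le> x" if x: "0 < x" "x < min \<delta> y" for x
    proof -
      have "(f y / y ^ n)\<^sup>2 \<le> (f x / x ^ n)\<^sup>2"
      proof (rule square_quotient_power_antimono[where f' = f'])
        show "continuous_on {x..y} f"
          using cont by (rule continuous_on_subset) (use x \<open>y \<le> 1\<close> in auto)
      qed (use x \<open>y \<le> 1\<close> deriv_at growth in auto)
      then have "\<bar>f y / y ^ n\<bar> \<le> \<bar>f x / x ^ n\<bar>"
        by (simp only: abs_le_square_iff)
      also have "\<dots> \<le> x"
        using \<delta>[of x] x by (simp add: field_simps)
      finally show ?thesis .
    qed
    have "\<bar>f y / y ^ n\<bar> \<le> 0"
    proof (rule dense_ge_bounded)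
      show "0 < min \<delta> y"
        using \<open>0 < \<delta>\<close> \<open>0 < y\<close> by simp
    qed (rule small)
    then show ?thesis
      using \<open>0 < y\<close> by (simp only: abs_le_zero_iff divide_eq_0_iff) simp
  qed (simp add: zero)
qed

end
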